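(* Let $\tau$ be a functional signature and let $\mathfrak{A},\mathfrak{B}$ be finitely generated $\tau$-algebras. Then $\mathfrak{B}$ is contained in the pseudovariety generated by $\mathfrak{A}$ if and only if the natural mapping from $\operatorname{Clo}(\mathfrak{A})$ onto $\operatorname{Clo}(\mathfrak{B})$ is well-defined and uniformly continuous with respect to pointwise convergence (i.e. with respect to the uniformities of pointwise convergence on $\operatorname{Clo}(\mathfrak{A})$ and $\operatorname{Clo}(\mathfrak{B})$).
   Context: Algebras are nonempty; $A$ denotes the domain of $\mathfrak{A}$. The pseudovariety generated by $\mathfrak{A}$ is the smallest class of $\tau$-algebras containing $\mathfrak{A}$ and closed under finite products, subalgebras, and homomorphic images (including isomorphic copies). For $k\ge1$, $T_k$ is the set of abstract $\tau$-terms over the variables $x_1,\dots,x_k$, and for $t\in T_k$, $t^{\mathfrak{A}}\colon A^k\to A$ is the induced term operation. $\operatorname{Clo}(\mathfrak{A})=\{t^{\mathfrak{A}}\mid t\in T_k,\ k\ge 1\}$ is the term clone, with $k$-ary part $\operatorname{Clo}(\mathfrak{A})_k=\{t^{\mathfrak{A}}\mid t\in T_k\}$. The natural mapping $\operatorname{Clo}(\mathfrak{A})\to\operatorname{Clo}(\mathfrak{B})$ is $t^{\mathfrak{A}}\mapsto t^{\mathfrak{B}}$ ($t\in T_k$, $k\ge1$); it is well-defined if $s^{\mathfrak{A}}=t^{\mathfrak{A}}$ implies $s^{\mathfrak{B}}=t^{\mathfrak{B}}$ for all $k\ge1$ and $s,t\in T_k$. The uniformity of pointwise convergence on $\operatorname{Clo}(\mathfrak{A})$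 is, for each $k\ge1$, the filter on $\operatorname{Clo}(\mathfrak{A})_k\times\operatorname{Clo}(\mathfrak{A})_k$ generated by the sets $\{(f,g)\mid f(\overline{a})=g(\overline{a})\}$, $\overline{a}\in A^k$. An arity-preserving map between clones is uniformly continuous if for every $k\ge1$ its restriction to $k$-ary elements is uniformly continuous (preimages of entourages are entourages). *)

theory Defs
  imports Complex_Main "HOL-Library.FuncSet" "HOL-Library.NList"
begin

section \<open>Algebras over a functional signature\<close>

text \<open>Symbols of arity 0 (constants) and the empty signature are allowed.\<close>

record 'f signature =
  syms :: "'f set"
  arity :: "'f \<Rightarrow> nat"

text \<open>The value of an interpretation matters only for symbols of the signature and
  argument lists of the right length over the carrier; no notion below depends on the rest.\<close>

record ('f, 'a) algebra =
  carrier :: "'a set"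
  intp :: "'f \<Rightarrow> 'a list \<Rightarrow> 'a"

definition subuniverse :: "'f signature \<Rightarrow> ('f, 'a) algebra \<Rightarrow> 'a set \<Rightarrow> bool" where
  "subuniverse \<sigma> A S \<longleftrightarrow> S \<subseteq> carrier A \<and>
     (\<forall>f\<in>syms \<sigma>. \<forall>xs\<in>nlists (arity \<sigma> f) S. intp A f xs \<in> S)"

definition is_algebra :: "'f signature \<Rightarrow> ('f, 'a) algebra \<Rightarrow> bool" where
  "is_algebra \<sigma> A \<longleftrightarrow> carrier A \<noteq> {} \<and> subuniverse \<sigma> A (carrier A)"

definition finitely_generated :: "'f signature \<Rightarrow> ('f, 'a) algebra \<Rightarrow> bool" where
  "finitely_generated \<sigma> A \<longleftrightarrow>
     (\<exists>X. finite X \<and> X \<subseteq> carrier A \<and> (subuniverse \<sigma> A) hull X = carrier A)"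

definition is_hom ::
  "'f signature \<Rightarrow> ('a \<Rightarrow> 'b) \<Rightarrow> ('f, 'a) algebra \<Rightarrow> ('f, 'b) algebra \<Rightarrow> bool" where
  "is_hom \<sigma> h A B \<longleftrightarrow> h ` carrier A \<subseteq> carrier B \<and>
     (\<forall>f\<in>syms \<sigma>. \<forall>xs\<in>nlists (arity \<sigma> f) (carrier A).
        h (intp A f xs) = intp B f (map h xs))"

definition hom_image :: "'f signature \<Rightarrow> ('f, 'a) algebra \<Rightarrow> ('f, 'b) algebra \<Rightarrow> bool" where
  "hom_image \<sigma> A B \<longleftrightarrow> (\<exists>h. is_hom \<sigma> h A B \<and> h ` carrier A = carrier B)"

definition isomorphic :: "'f signature \<Rightarrow> ('f, 'a) algebra \<Rightarrow> ('f, 'b) algebra \<Rightarrow> bool" where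
  "isomorphic \<sigma> A B \<longleftrightarrow> (\<exists>h. is_hom \<sigma> h A B \<and> bij_betw h (carrier A) (carrier B))"

definition subalgebra :: "'f signature \<Rightarrow> ('f, 'a) algebra \<Rightarrow> ('f, 'a) algebra \<Rightarrow> bool" where
  "subalgebra \<sigma> S A \<longleftrightarrow> is_algebra \<sigma> S \<and> carrier S \<subseteq> carrier A \<and>
     (\<forall>f\<in>syms \<sigma>. \<forall>xs\<in>nlists (arity \<sigma> f) (carrier S). intp S f xs = intp A f xs)"

section \<open>Pseudovarieties\<close>

text \<open>A class of algebras cannot range over all types. The smallest class is therefore
  formed among the algebras whose elements are finitely nested tuples over the carrier type of
  the generating algebra. This universe contains all finite products of its algebras and, up to
  isomorphism, all homomorphic images of its algebras over arbitrary types (lemma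
  \<open>in_pseudovariety_hom_image\<close>), so nothing of the class is lost.\<close>

datatype 'u nested = Atom 'u | Tuple (entries: "'u nested list")

text \<open>The direct product of a finite list of algebras; the empty list gives the one-element
  algebra.\<close>

definition product :: "('f, 'u nested) algebra list \<Rightarrow> ('f, 'u nested) algebra" where
  "product Cs =
     \<lparr>carrier = Tuple ` listset (map carrier Cs),
      intp = (\<lambda>f xs. Tuple (map (\<lambda>i. intp (Cs ! i) f (map (\<lambda>x. entries x ! i) xs))
                              [0..<length Cs]))\<rparr>"

inductive pseudovariety ::
  "'f signature \<Rightarrow> ('f, 'a) algebra \<Rightarrow> ('f, 'a nested) algebra \<Rightarrow> bool"
  for \<sigma> A where
  generator: "is_algebra \<sigma> C \<Longrightarrow> isomorphic \<sigma> A C \<Longrightarrow> pseudovariety \<sigma> A C"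
| product: "\<forall>C\<in>set Cs. pseudovariety \<sigma> A C \<Longrightarrow> pseudovariety \<sigma> A (product Cs)"
| subalgebra: "pseudovariety \<sigma> A C \<Longrightarrow> subalgebra \<sigma> S C \<Longrightarrow> pseudovariety \<sigma> A S"
| hom_image: "pseudovariety \<sigma> A C \<Longrightarrow> is_algebra \<sigma> D \<Longrightarrow> hom_image \<sigma> C D \<Longrightarrow> pseudovariety \<sigma> A D"

definition in_pseudovariety ::
  "'f signature \<Rightarrow> ('f, 'a) algebra \<Rightarrow> ('f, 'b) algebra \<Rightarrow> bool" where
  "in_pseudovariety \<sigma> A B \<longleftrightarrow> is_algebra \<sigma> B \<and> (\<exists>C. pseudovariety \<sigma> A C \<and> isomorphic \<sigma> C B)"

lemma is_hom_comp:
  assumes "is_hom \<sigma> g A B" "is_hom \<sigma> h B C"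
  shows "is_hom \<sigma> (h \<circ> g) A C"
  unfolding is_hom_def
proof (intro conjI ballI)
  show "(h \<circ> g) ` carrier A \<subseteq> carrier C"
    using assms unfolding is_hom_def image_subset_iff by simp
next
  fix f xs assume f: "f \<in> syms \<sigma>" and xs: "xs \<in> nlists (arity \<sigma> f) (carrier A)"
  have "map g xs \<in> nlists (arity \<sigma> f) (carrier B)"
    using xs assms(1) unfolding is_hom_def nlists_def by auto
  then show "(h \<circ> g) (intp A f xs) = intp C f (map (h \<circ> g) xs)"
    using assms f xs unfolding is_hom_def by simp
qed

lemma ex_isomorphic_copy:
  assumes D: "is_algebra \<sigma> D" and r: "inj_on r (carrier D)"
  obtains E where "is_algebra \<sigma> E" "is_hom \<sigma> r D E" "bij_betw r (carrier D) (carrier E)"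
    "is_hom \<sigma> (inv_into (carrier D) r) E D"
proof
  let ?i = "inv_into (carrier D) r"
  let ?E = "\<lparr>carrier = r ` carrier D, intp = (\<lambda>f xs. r (intp D f (map ?i xs)))\<rparr>"
  have cl: "intp D f xs \<in> carrier D"
    if "f \<in> syms \<sigma>" "xs \<in> nlists (arity \<sigma> f) (carrier D)" for f xs
    using D that unfolding is_algebra_def subuniverse_def by blast
  have lift: "map ?i xs \<in> nlists n (carrier D)"
    if "xs \<in> nlists n (r ` carrier D)" for n xs
    using that inv_into_into[of _ r "carrier D"] unfolding nlists_def by auto
  have "r (intp D f (map ?i xs)) \<in> r ` carrier D"
    if "f \<in> syms \<sigma>" "xs \<in> nlists (arity \<sigma> f) (r ` carrier D)" for f xs
    by (rule imageI, rule cl[OF that(1) lift[OF that(2)]])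
  then show "is_algebra \<sigma> ?E"
    using D by (simp add: is_algebra_def subuniverse_def)
  have inv: "map (?i \<circ> r) xs = xs" if "xs \<in> nlists n (carrier D)" for n xs
    using that inv_into_f_f[OF r] unfolding nlists_def by (intro map_idI) auto
  show "is_hom \<sigma> r D ?E"
    using inv by (simp add: is_hom_def)
  show "bij_betw r (carrier D) (carrier ?E)"
    using r by (simp add: bij_betw_def)
  show "is_hom \<sigma> ?i ?E D"
    unfolding is_hom_def
  proof (intro conjI ballI)
    show "?i ` carrier ?E \<subseteq> carrier D"
      by (auto intro: inv_into_into)
  next
    fix f xs assume f: "f \<in> syms \<sigma>" and xs: "xs \<in> nlists (arity \<sigma> f) (carrier ?E)"
    have "intp D f (map ?i xs) \<in> carrier D"
      by (rule cl[OF f]) (use xs lift in simp)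
    then show "?i (intp ?E f xs) = intp D f (map ?i xs)"
      by (simp add: inv_into_f_f[OF r])
  qed
qed

lemma in_pseudovariety_refl:
  assumes "is_algebra \<sigma> A"
  shows "in_pseudovariety \<sigma> A A"
proof -
  have inj: "inj_on Atom (carrier A)" by (simp add: inj_on_def)
  obtain E where E: "is_algebra \<sigma> E" "is_hom \<sigma> Atom A E" "bij_betw Atom (carrier A) (carrier E)"
    "is_hom \<sigma> (inv_into (carrier A) Atom) E A"
    using ex_isomorphic_copy[OF assms inj] .
  have "pseudovariety \<sigma> A E"
  proof (rule pseudovariety.generator)
    show "is_algebra \<sigma> E" by (rule E(1))
    show "isomorphic \<sigma> A E" unfolding isomorphic_def using E(2,3) by blast
  qed
  moreover have "isomorphic \<sigma> E A"
    using E(4) bij_betw_inv_into[OF E(3)] unfolding isomorphic_def by blast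
  ultimately show ?thesis
    using assms unfolding in_pseudovariety_def by blast
qed

lemma in_pseudovariety_hom_image:
  fixes A :: "('f, 'a) algebra" and B :: "('f, 'b) algebra" and D :: "('f, 'd) algebra"
  assumes B: "in_pseudovariety \<sigma> A B" and D: "is_algebra \<sigma> D" and BD: "hom_image \<sigma> B D"
  shows "in_pseudovariety \<sigma> A D"
proof -
  obtain C g where C: "pseudovariety \<sigma> A C" and g: "is_hom \<sigma> g C B"
    "bij_betw g (carrier C) (carrier B)"
    using B unfolding in_pseudovariety_def isomorphic_def by blast
  obtain h where h: "is_hom \<sigma> h B D" "h ` carrier B = carrier D"
    using BD by (auto simp: hom_image_def)
  have hg: "is_hom \<sigma> (h \<circ> g) C D" by (rule is_hom_comp[OF g(1) h(1)])
  have im: "(h \<circ> g) ` carrier C = carrier D"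
    using g(2) h(2) by (metis bij_betw_def image_comp)
  define r where "r = inv_into (carrier C) (h \<circ> g)"
  have r: "inj_on r (carrier D)"
    unfolding r_def using inj_on_inv_into[of "carrier D" "h \<circ> g" "carrier C"] im by simp
  obtain E where E: "is_algebra \<sigma> E" "is_hom \<sigma> r D E" "bij_betw r (carrier D) (carrier E)"
    "is_hom \<sigma> (inv_into (carrier D) r) E D"
    using ex_isomorphic_copy[OF D r] .
  have "hom_image \<sigma> C E"
    unfolding hom_image_def
  proof (intro exI conjI)
    show "is_hom \<sigma> (r \<circ> (h \<circ> g)) C E" by (rule is_hom_comp[OF hg E(2)])
    show "(r \<circ> (h \<circ> g)) ` carrier C = carrier E"
      using im E(3) by (metis bij_betw_def image_comp)
  qed
  then have "pseudovariety \<sigma> A E"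
    by (rule pseudovariety.hom_image[OF C E(1)])
  moreover have "isomorphic \<sigma> E D"
    using E(4) bij_betw_inv_into[OF E(3)] unfolding isomorphic_def by blast
  ultimately show ?thesis
    using D unfolding in_pseudovariety_def by blast
qed

section \<open>Term clones\<close>

datatype 'f trm = Var nat | Fun 'f "'f trm list"

text \<open>The set \<open>T_k\<close>; the variables \<open>x_1, \<dots>, x_k\<close> are \<open>Var 0, \<dots>, Var (k - 1)\<close>.\<close>

inductive_set terms :: "'f signature \<Rightarrow> nat \<Rightarrow> 'f trm set"
  for \<sigma> k where
  "i < k \<Longrightarrow> Var i \<in> terms \<sigma> k"
| "f \<in> syms \<sigma> \<Longrightarrow> length ts = arity \<sigma> f \<Longrightarrow> \<forall>t\<in>set ts. t \<in> terms \<sigma> k \<Longrightarrow> Fun f ts \<in> terms \<sigma> k"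

primrec eval :: "('f, 'a) algebra \<Rightarrow> 'a list \<Rightarrow> 'f trm \<Rightarrow> 'a" where
  "eval A as (Var i) = as ! i"
| "eval A as (Fun f ts) = intp A f (map (eval A as) ts)"

text \<open>A \<open>k\<close>-ary operation on the carrier is an extensional function on the lists of length
  \<open>k\<close> over the carrier, so that equality of operations is equality in HOL.\<close>

definition term_op :: "('f, 'a) algebra \<Rightarrow> nat \<Rightarrow> 'f trm \<Rightarrow> 'a list \<Rightarrow> 'a" where
  "term_op A k t = restrict (\<lambda>as. eval A as t) (nlists k (carrier A))"

definition Clo :: "'f signature \<Rightarrow> ('f, 'a) algebra \<Rightarrow> nat \<Rightarrow> ('a list \<Rightarrow> 'a) set" where
  "Clo \<sigma> A k = term_op A k ` terms \<sigma> k"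

definition natural_map_well_defined ::
  "'f signature \<Rightarrow> ('f, 'a) algebra \<Rightarrow> ('f, 'b) algebra \<Rightarrow> bool" where
  "natural_map_well_defined \<sigma> A B \<longleftrightarrow>
     (\<forall>k\<ge>1. \<forall>s\<in>terms \<sigma> k. \<forall>t\<in>terms \<sigma> k.
        term_op A k s = term_op A k t \<longrightarrow> term_op B k s = term_op B k t)"

text \<open>The \<open>k\<close>-ary part of the natural mapping; meaningful on \<open>Clo \<sigma> A k\<close> when the mapping is
  well-defined.\<close>

definition natural_map ::
  "'f signature \<Rightarrow> ('f, 'a) algebra \<Rightarrow> ('f, 'b) algebra \<Rightarrow> nat \<Rightarrow> ('a list \<Rightarrow> 'a) \<Rightarrow> ('b list \<Rightarrow> 'b)"
  where
  "natural_map \<sigma> A B k f =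
     (THE g. \<exists>t\<in>terms \<sigma> k. f = term_op A k t \<and> g = term_op B k t)"

text \<open>The filter on \<open>Clo \<sigma> A k \<times> Clo \<sigma> A k\<close> generated by the sets of pairs that agree at one
  tuple. As a filter on the whole type it is concentrated on \<open>Clo \<sigma> A k \<times> Clo \<sigma> A k\<close>.\<close>

definition pointwise_uniformity ::
  "'f signature \<Rightarrow> ('f, 'a) algebra \<Rightarrow> nat \<Rightarrow> (('a list \<Rightarrow> 'a) \<times> ('a list \<Rightarrow> 'a)) filter" where
  "pointwise_uniformity \<sigma> A k =
     (INF as\<in>nlists k (carrier A).
        principal {(f, g) \<in> Clo \<sigma> A k \<times> Clo \<sigma> A k. f as = g as})"

text \<open>Preimages of entourages under \<open>\<xi> k \<times> \<xi> k\<close> are entourages.\<close>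

definition clone_uniformly_continuous ::
  "'f signature \<Rightarrow> ('f, 'a) algebra \<Rightarrow> ('f, 'b) algebra \<Rightarrow>
   (nat \<Rightarrow> ('a list \<Rightarrow> 'a) \<Rightarrow> ('b list \<Rightarrow> 'b)) \<Rightarrow> bool" where
  "clone_uniformly_continuous \<sigma> A B \<xi> \<longleftrightarrow>
     (\<forall>k\<ge>1. filterlim (map_prod (\<xi> k) (\<xi> k))
        (pointwise_uniformity \<sigma> B k) (pointwise_uniformity \<sigma> A k))"

end

theory Submission
  imports Defs
begin

text \<open>Call a tuple \<open>cs\<close> of an algebra \<open>C\<close> finitely determined by \<open>A\<close> if there are finitely many
  tuples of \<open>A\<close> such that any two terms that agree at each of these tuples in \<open>A\<close> agree at \<open>cs\<close>
  in \<open>C\<close>. Unfolding the uniformities, the natural mapping is well-defined and uniformly continuous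
  iff every nonempty tuple of \<open>B\<close> is finitely determined by \<open>A\<close>
  (\<open>natural_map_uniformly_continuous_iff\<close>).

  The class of algebras all of whose tuples are finitely determined by \<open>A\<close> contains \<open>A\<close> and is
  closed under subalgebras, homomorphic images (lift the tuple along the homomorphism) and finite
  products (unite the finite sets that belong to the coordinates), so it contains the
  pseudovariety generated by \<open>A\<close> (\<open>pseudovariety_finitely_determined\<close>).

  Conversely, let \<open>bs\<close> be a \<open>k\<close>-tuple, \<open>k \<ge> 1\<close>, that generates \<open>B\<close>, determined by the tuples
  \<open>as\<^sub>1, \<dots>, as\<^sub>m\<close> of \<open>A\<close>. Reading these as the rows of a matrix, its \<open>k\<close> columns are elements of
  \<open>A\<^sup>m\<close>. Two terms agree at the columns in \<open>A\<^sup>m\<close> iff they agree at every row in \<open>A\<close>, and then they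
  agree at \<open>bs\<close>. Hence sending the value of a term at the columns to its value at \<open>bs\<close> is a
  homomorphism from the subalgebra generated by the columns onto \<open>B\<close>
  (\<open>generated_subalgebra_hom_image\<close>).\<close>

section \<open>Evaluation of terms\<close>

text \<open>Together with \<open>nlists_def\<close>, these two conditional rules make the simplifier loop.\<close>

declare nlistsE_length [simp del] nlistsE_set [simp del]

lemma eval_in_subuniverse:
  assumes "t \<in> terms \<sigma> k" "subuniverse \<sigma> A S" "as \<in> nlists k S"
  shows "eval A as t \<in> S"
  using assms(1)
proof (induction t rule: terms.induct)
  case (1 i)
  then show ?case using assms(3) by (auto simp: nlists_def)
next
  case (2 f ts)
  then have "map (eval A as) ts \<in> nlists (arity \<sigma> f) S"
    by (auto simp: nlists_def)
  then show ?case using 2(1) assms(2) by (simp add: subuniverse_def)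
qed

lemma eval_in_carrier:
  assumes "is_algebra \<sigma> A" "t \<in> terms \<sigma> k" "as \<in> nlists k (carrier A)"
  shows "eval A as t \<in> carrier A"
  using assms eval_in_subuniverse by (metis is_algebra_def)

lemma hom_eval:
  assumes "is_algebra \<sigma> A" "is_hom \<sigma> h A B" "t \<in> terms \<sigma> k" "as \<in> nlists k (carrier A)"
  shows "h (eval A as t) = eval B (map h as) t"
  using assms(3)
proof (induction t rule: terms.induct)
  case (1 i)
  then show ?case using assms(4) by (simp add: nlists_def)
next
  case (2 f ts)
  have "map (eval A as) ts \<in> nlists (arity \<sigma> f) (carrier A)"
    using 2 assms(1,4) by (auto simp: nlists_def intro: eval_in_carrier)
  then have "h (eval A as (Fun f ts)) = intp B f (map h (map (eval A as) ts))"
    using 2(1) assms(2) by (simp add: is_hom_def)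
  also have "map h (map (eval A as) ts) = map (eval B (map h as)) ts"
    using 2 by simp
  finally show ?case by simp
qed

lemma term_op_eq_iff:
  "term_op A k s = term_op A k t \<longleftrightarrow> (\<forall>as\<in>nlists k (carrier A). eval A as s = eval A as t)"
  by (auto simp: term_op_def restrict_def fun_eq_iff)

section \<open>Finite products\<close>

lemma in_listset_iff:
  "xs \<in> listset As \<longleftrightarrow> length xs = length As \<and> (\<forall>i<length As. xs ! i \<in> As ! i)"
proof (induction As arbitrary: xs)
  case Nil
  then show ?case by simp
next
  case (Cons S As)
  show ?case
    by (cases xs) (auto simp: set_Cons_def Cons.IH All_less_Suc2)
qed

lemma in_carrier_product_iff:
  "x \<in> carrier (product Cs) \<longleftrightarrow>
     (\<exists>ys. x = Tuple ys \<and> length ys = length Cs \<and> (\<forall>i<length Cs. ys ! i \<in> carrier (Cs ! i)))"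
  by (auto simp: product_def in_listset_iff image_iff)

lemma intp_product:
  "intp (product Cs) f xs =
    Tuple (map (\<lambda>i. intp (Cs ! i) f (map (\<lambda>x. entries x ! i) xs)) [0..<length Cs])"
  by (simp add: product_def)

lemma map_entries_in_nlists:
  assumes "xs \<in> nlists n (carrier (product Cs))" "i < length Cs"
  shows "map (\<lambda>x. entries x ! i) xs \<in> nlists n (carrier (Cs ! i))"
  using assms by (auto simp: nlists_def in_carrier_product_iff subset_iff)

lemma is_algebra_product:
  assumes "\<forall>C\<in>set Cs. is_algebra \<sigma> C"
  shows "is_algebra \<sigma> (product Cs)"
proof -
  have alg: "is_algebra \<sigma> (Cs ! i)" if "i < length Cs" for i
    using assms that by simp
  have "Tuple (map (\<lambda>C. SOME x. x \<in> carrier C) Cs) \<in> carrier (product Cs)"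
    using alg by (auto simp: in_carrier_product_iff is_algebra_def some_in_eq)
  moreover have "intp (product Cs) f xs \<in> carrier (product Cs)"
    if "f \<in> syms \<sigma>" "xs \<in> nlists (arity \<sigma> f) (carrier (product Cs))" for f xs
  proof -
    have "intp (Cs ! i) f (map (\<lambda>x. entries x ! i) xs) \<in> carrier (Cs ! i)" if "i < length Cs" for i
      using alg[OF that] map_entries_in_nlists[OF _ that] \<open>f \<in> syms \<sigma>\<close>
        \<open>xs \<in> nlists (arity \<sigma> f) (carrier (product Cs))\<close>
      by (auto simp: is_algebra_def subuniverse_def)
    then show ?thesis
      unfolding in_carrier_product_iff by (simp add: intp_product)
  qed
  ultimately show ?thesis
    by (auto simp: is_algebra_def subuniverse_def)
qed

lemma eval_product:
  assumes "t \<in> terms \<sigma> k" "cs \<in> nlists k (carrier (product Cs))"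
  shows "eval (product Cs) cs t =
    Tuple (map (\<lambda>i. eval (Cs ! i) (map (\<lambda>x. entries x ! i) cs) t) [0..<length Cs])"
  using assms(1)
proof (induction t rule: terms.induct)
  case (1 i)
  then have len: "i < length cs" and "cs ! i \<in> carrier (product Cs)"
    using assms(2) by (auto simp: nlists_def)
  then obtain ys where "cs ! i = Tuple ys" "length ys = length Cs"
    by (auto simp: in_carrier_product_iff)
  then show ?case using len map_nth[of ys] by simp
next
  case (2 f ts)
  have arg: "map (\<lambda>x. entries x ! i) (map (eval (product Cs) cs) ts) =
      map (eval (Cs ! i) (map (\<lambda>x. entries x ! i) cs)) ts" if "i < length Cs" for i
    using 2 that by simp
  show ?case
    unfolding eval.simps intp_product by (simp add: arg del: map_map)
qed

section \<open>Finitely determined tuples\<close>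

text \<open>Finitely many tuples of \<open>A\<close>, of the same length as \<open>cs\<close>, suffice to tell apart any two
  terms in \<open>length cs\<close> variables that differ at \<open>cs\<close> in \<open>C\<close>.\<close>

definition finitely_determined ::
  "'f signature \<Rightarrow> ('f, 'a) algebra \<Rightarrow> ('f, 'c) algebra \<Rightarrow> 'c list \<Rightarrow> bool" where
  "finitely_determined \<sigma> A C cs \<longleftrightarrow>
     (\<exists>F. finite F \<and> F \<subseteq> nlists (length cs) (carrier A) \<and>
        (\<forall>s\<in>terms \<sigma> (length cs). \<forall>t\<in>terms \<sigma> (length cs).
           (\<forall>as\<in>F. eval A as s = eval A as t) \<longrightarrow> eval C cs s = eval C cs t))"

lemma finitely_determined_refl:
  assumes "set as \<subseteq> carrier A"
  shows "finitely_determined \<sigma> A A as"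
  unfolding finitely_determined_def
  using assms by (intro exI[of _ "{as}"]) (auto simp: nlists_def)

lemma finitely_determined_map_hom:
  assumes "finitely_determined \<sigma> A C cs" "is_algebra \<sigma> C" "is_hom \<sigma> h C D" "set cs \<subseteq> carrier C"
  shows "finitely_determined \<sigma> A D (map h cs)"
proof -
  have "eval D (map h cs) t = h (eval C cs t)" if "t \<in> terms \<sigma> (length cs)" for t
    using hom_eval[OF assms(2,3) that, of cs] assms(4) by (simp add: nlists_def)
  then show ?thesis
    using assms(1) unfolding finitely_determined_def by (metis length_map)
qed

lemma finitely_determined_hom_image:
  assumes C: "is_algebra \<sigma> C" "\<forall>cs. set cs \<subseteq> carrier C \<longrightarrow> finitely_determined \<sigma> A C cs"
    and CD: "hom_image \<sigma> C D" and ds: "set ds \<subseteq> carrier D"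
  shows "finitely_determined \<sigma> A D ds"
proof -
  obtain h where h: "is_hom \<sigma> h C D" "h ` carrier C = carrier D"
    using CD by (auto simp: hom_image_def)
  have "ds \<in> map h ` lists (carrier C)"
    using ds h(2) by (metis in_lists_conv_set lists_image subsetD)
  then obtain cs where "ds = map h cs" "set cs \<subseteq> carrier C" by auto
  then show ?thesis
    using finitely_determined_map_hom[OF _ C(1) h(1)] C(2) by blast
qed

lemma finitely_determined_subalgebra:
  assumes "finitely_determined \<sigma> A C cs" "subalgebra \<sigma> S C" "set cs \<subseteq> carrier S"
  shows "finitely_determined \<sigma> A S cs"
proof -
  have "is_algebra \<sigma> S" "is_hom \<sigma> id S C"
    using assms(2) by (auto simp: subalgebra_def is_hom_def)
  then have "eval S cs t = eval C cs t" if "t \<in> terms \<sigma> (length cs)" for t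
    using hom_eval[OF _ _ that, of S id C cs] assms(3) by (simp add: nlists_def)
  then show ?thesis
    using assms(1) unfolding finitely_determined_def by metis
qed

lemma finitely_determined_product:
  assumes Cs: "\<forall>C\<in>set Cs. \<forall>cs. set cs \<subseteq> carrier C \<longrightarrow> finitely_determined \<sigma> A C cs"
    and cs: "set cs \<subseteq> carrier (product Cs)"
  shows "finitely_determined \<sigma> A (product Cs) cs"
proof -
  define k where "k = length cs"
  have csk: "cs \<in> nlists k (carrier (product Cs))"
    using cs by (simp add: nlists_def k_def)
  define row where "row i = map (\<lambda>x. entries x ! i) cs" for i
  define determines where "determines F i \<longleftrightarrow> finite F \<and> F \<subseteq> nlists k (carrier A) \<and>
      (\<forall>s\<in>terms \<sigma> k. \<forall>t\<in>terms \<sigma> k. (\<forall>as\<in>F. eval A as s = eval A as t) \<longrightarrow>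
         eval (Cs ! i) (row i) s = eval (Cs ! i) (row i) t)" for F i
  have "\<exists>F. determines F i" if "i < length Cs" for i
  proof -
    have "finitely_determined \<sigma> A (Cs ! i) (row i)"
      using Cs map_entries_in_nlists[OF csk that] that unfolding row_def nlists_def by auto
    then show ?thesis
      unfolding finitely_determined_def determines_def by (simp add: row_def k_def)
  qed
  then obtain F where F: "\<And>i. i < length Cs \<Longrightarrow> determines (F i) i" by metis
  have "eval (product Cs) cs s = eval (product Cs) cs t"
    if "s \<in> terms \<sigma> k" "t \<in> terms \<sigma> k"
      "\<forall>as\<in>(\<Union>i<length Cs. F i). eval A as s = eval A as t" for s t
  proof -
    have "eval (Cs ! i) (row i) s = eval (Cs ! i) (row i) t" if "i < length Cs" for i
      using F[OF that] that
        \<open>s \<in> terms \<sigma> k\<close> \<open>t \<in> terms \<sigma> k\<close> \<open>\<forall>as\<in>(\<Union>i<length Cs. F i). eval A as s = eval A as t\<close>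
      unfolding determines_def by blast
    then show ?thesis
      using that(1,2) by (simp add: eval_product[OF _ csk] row_def[symmetric])
  qed
  then show ?thesis
    unfolding finitely_determined_def k_def[symmetric]
  proof (intro exI conjI)
    show "finite (\<Union>i<length Cs. F i)" "(\<Union>i<length Cs. F i) \<subseteq> nlists k (carrier A)"
      using F unfolding determines_def by blast+
  qed blast
qed

lemma pseudovariety_finitely_determined:
  assumes "is_algebra \<sigma> A" "pseudovariety \<sigma> A C"
  shows "is_algebra \<sigma> C \<and> (\<forall>cs. set cs \<subseteq> carrier C \<longrightarrow> finitely_determined \<sigma> A C cs)"
  using assms(2)
proof (induction rule: pseudovariety.induct)
  case (generator C)
  have "hom_image \<sigma> A C"
    using generator(2) by (auto simp: isomorphic_def hom_image_def bij_betw_def)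
  then show ?case
    using generator(1) finitely_determined_hom_image[OF assms(1)] finitely_determined_refl by blast
next
  case (product Cs)
  then show ?case
    by (simp add: is_algebra_product finitely_determined_product)
next
  case (subalgebra C S)
  then show ?case
    using finitely_determined_subalgebra by (metis subalgebra_def subset_trans)
next
  case (hom_image C D)
  then show ?case
    using finitely_determined_hom_image by blast
qed

lemma in_pseudovariety_finitely_determined:
  assumes "is_algebra \<sigma> A" "in_pseudovariety \<sigma> A B" "set bs \<subseteq> carrier B"
  shows "finitely_determined \<sigma> A B bs"
proof -
  obtain C where C: "pseudovariety \<sigma> A C" "hom_image \<sigma> C B"
    using assms(2) by (auto simp: in_pseudovariety_def isomorphic_def hom_image_def bij_betw_def)
  then show ?thesis
    using pseudovariety_finitely_determined[OF assms(1) C(1)] assms(3)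
      finitely_determined_hom_image by blast
qed

section \<open>Uniform continuity of the natural mapping\<close>

lemma natural_map_term_op:
  assumes "natural_map_well_defined \<sigma> A B" "k \<ge> 1" "t \<in> terms \<sigma> k"
  shows "natural_map \<sigma> A B k (term_op A k t) = term_op B k t"
  unfolding natural_map_def
  using assms unfolding natural_map_well_defined_def by (intro the_equality) metis+

text \<open>Finite intersections of the generating sets form a base of the uniformity. As a subset of
  the type, the empty intersection contains also pairs that are not in \<open>Clo \<sigma> A k \<times> Clo \<sigma> A k\<close>, of
  which the right-hand side says nothing. This is harmless because the carrier is nonempty, so
  that a tuple can be added to \<open>F\<close>.\<close>

lemma eventually_pointwise_uniformity:
  assumes "carrier A \<noteq> {}"
  shows "eventually P (pointwise_uniformity \<sigma> A k) \<longleftrightarrow>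
    (\<exists>F. finite F \<and> F \<subseteq> nlists k (carrier A) \<and>
      (\<forall>s\<in>terms \<sigma> k. \<forall>t\<in>terms \<sigma> k. (\<forall>as\<in>F. eval A as s = eval A as t) \<longrightarrow>
         P (term_op A k s, term_op A k t)))" (is "?L \<longleftrightarrow> ?R")
proof -
  let ?E = "\<lambda>as. {(f, g) \<in> Clo \<sigma> A k \<times> Clo \<sigma> A k. f as = g as}"
  have base: "?L \<longleftrightarrow> (\<exists>F\<subseteq>nlists k (carrier A). finite F \<and> (\<forall>p\<in>(\<Inter>as\<in>F. ?E as). P p))"
    unfolding pointwise_uniformity_def
    by (subst eventually_INF)
      (auto simp: INF_principal_finite eventually_principal cong: conj_cong)
  have op: "term_op A k t as = eval A as t" if "as \<in> nlists k (carrier A)" for as t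
    using that by (simp add: term_op_def)
  show ?thesis
  proof
    assume ?L
    then obtain F where F: "F \<subseteq> nlists k (carrier A)" "finite F" "\<forall>p\<in>(\<Inter>as\<in>F. ?E as). P p"
      using base by blast
    have "P (term_op A k s, term_op A k t)"
      if "s \<in> terms \<sigma> k" "t \<in> terms \<sigma> k" "\<forall>as\<in>F. eval A as s = eval A as t" for s t
      using that F op by (intro F(3)[rule_format]) (auto simp: Clo_def)
    then show ?R using F by blast
  next
    assume ?R
    then obtain F where F: "finite F" "F \<subseteq> nlists k (carrier A)"
      "\<And>s t. s \<in> terms \<sigma> k \<Longrightarrow> t \<in> terms \<sigma> k \<Longrightarrow> \<forall>as\<in>F. eval A as s = eval A as t \<Longrightarrow>
         P (term_op A k s, term_op A k t)"
      by blast
    obtain a where "a \<in> carrier A" using assms by blast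
    then have a: "replicate k a \<in> nlists k (carrier A)" by (auto simp: nlists_def)
    have "P p" if p: "p \<in> (\<Inter>as\<in>insert (replicate k a) F. ?E as)" for p
    proof -
      obtain s t where st: "s \<in> terms \<sigma> k" "t \<in> terms \<sigma> k" "p = (term_op A k s, term_op A k t)"
        using p by (auto simp: Clo_def)
      moreover have "\<forall>as\<in>F. eval A as s = eval A as t"
      proof
        fix as assume "as \<in> F"
        then have "term_op A k s as = term_op A k t as" using p st(3) by auto
        then show "eval A as s = eval A as t" using op \<open>as \<in> F\<close> F(2) by (metis subsetD)
      qed
      ultimately show ?thesis using F(3) by blast
    qed
    then have "\<exists>F\<subseteq>nlists k (carrier A). finite F \<and> (\<forall>p\<in>(\<Inter>as\<in>F. ?E as). P p)"
      using a F(1,2) by (intro exI[of _ "insert (replicate k a) F"]) blast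
    then show ?L using base by blast
  qed
qed

lemma natural_map_uniformly_continuous_iff:
  assumes "carrier A \<noteq> {}"
  shows "natural_map_well_defined \<sigma> A B \<and>
      clone_uniformly_continuous \<sigma> A B (natural_map \<sigma> A B) \<longleftrightarrow>
    (\<forall>bs. bs \<noteq> [] \<and> set bs \<subseteq> carrier B \<longrightarrow> finitely_determined \<sigma> A B bs)" (is "?L \<longleftrightarrow> ?R")
proof -
  have uc: "clone_uniformly_continuous \<sigma> A B (natural_map \<sigma> A B) \<longleftrightarrow> ?R"
    if wd: "natural_map_well_defined \<sigma> A B"
  proof -
    have fd: "(\<forall>\<^sub>F p in pointwise_uniformity \<sigma> A k. map_prod (natural_map \<sigma> A B k) (natural_map \<sigma> A B k) p
          \<in> {(f, g) \<in> Clo \<sigma> B k \<times> Clo \<sigma> B k. f bs = g bs}) \<longleftrightarrow> finitely_determined \<sigma> A B bs"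
      if "k \<ge> 1" "bs \<in> nlists k (carrier B)" for k bs
    proof -
      have "map_prod (natural_map \<sigma> A B k) (natural_map \<sigma> A B k) (term_op A k s, term_op A k t)
          \<in> {(f, g) \<in> Clo \<sigma> B k \<times> Clo \<sigma> B k. f bs = g bs} \<longleftrightarrow> eval B bs s = eval B bs t"
        if "s \<in> terms \<sigma> k" "t \<in> terms \<sigma> k" for s t
        using that \<open>k \<ge> 1\<close> \<open>bs \<in> nlists k (carrier B)\<close>
        by (simp add: natural_map_term_op[OF wd] Clo_def) (simp add: term_op_def)
      then show ?thesis
        using that(2) unfolding eventually_pointwise_uniformity[OF assms] finitely_determined_def
        by (auto simp: nlists_def)
    qed
    have "clone_uniformly_continuous \<sigma> A B (natural_map \<sigma> A B) \<longleftrightarrow>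
        (\<forall>k\<ge>1. \<forall>bs\<in>nlists k (carrier B). finitely_determined \<sigma> A B bs)"
      unfolding clone_uniformly_continuous_def pointwise_uniformity_def[of \<sigma> B]
        filterlim_INF filterlim_principal
      using fd by blast
    also have "\<dots> \<longleftrightarrow> ?R"
      by (auto simp: nlists_def Suc_le_eq)
    finally show ?thesis .
  qed
  moreover have "natural_map_well_defined \<sigma> A B" if ?R
    unfolding natural_map_well_defined_def term_op_eq_iff
  proof (intro allI impI ballI)
    fix k s t bs
    assume k: "1 \<le> k" and st: "s \<in> terms \<sigma> k" "t \<in> terms \<sigma> k"
      "\<forall>as\<in>nlists k (carrier A). eval A as s = eval A as t" and bs: "bs \<in> nlists k (carrier B)"
    have len: "length bs = k" by (rule nlistsE_length[OF bs])
    have "bs \<noteq> []" using k len by auto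
    then have "finitely_determined \<sigma> A B bs"
      using that nlistsE_set[OF bs] by blast
    then show "eval B bs s = eval B bs t"
      unfolding finitely_determined_def len using st by blast
  qed
  ultimately show ?thesis by blast
qed

section \<open>Generated subalgebras\<close>

lemma subuniverse_eval_image:
  assumes "is_algebra \<sigma> C" "cs \<in> nlists k (carrier C)"
  shows "subuniverse \<sigma> C (eval C cs ` terms \<sigma> k)"
  unfolding subuniverse_def
proof (intro conjI ballI)
  show "eval C cs ` terms \<sigma> k \<subseteq> carrier C"
    using assms eval_in_carrier by blast
next
  fix f xs assume f: "f \<in> syms \<sigma>" and xs: "xs \<in> nlists (arity \<sigma> f) (eval C cs ` terms \<sigma> k)"
  have "xs \<in> map (eval C cs) ` lists (terms \<sigma> k)"
    using xs by (metis in_lists_conv_set lists_image nlistsE_set subsetD)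
  then obtain ts where ts: "xs = map (eval C cs) ts" "set ts \<subseteq> terms \<sigma> k" by auto
  then have "Fun f ts \<in> terms \<sigma> k"
    using f nlistsE_length[OF xs] by (intro terms.intros) auto
  then show "intp C f xs \<in> eval C cs ` terms \<sigma> k"
    using ts(1) by (metis eval.simps(2) imageI)
qed

lemma generated_subalgebra_hom_image:
  assumes B: "is_algebra \<sigma> B" "bs \<in> nlists k (carrier B)"
      "(subuniverse \<sigma> B) hull (set bs) = carrier B"
    and C: "is_algebra \<sigma> C" "cs \<in> nlists k (carrier C)"
    and agree: "\<And>s t. s \<in> terms \<sigma> k \<Longrightarrow> t \<in> terms \<sigma> k \<Longrightarrow> eval C cs s = eval C cs t \<Longrightarrow>
      eval B bs s = eval B bs t"
  obtains S where "subalgebra \<sigma> S C" "hom_image \<sigma> S B"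
proof
  let ?T = "terms \<sigma> k"
  let ?S = "\<lparr>carrier = eval C cs ` ?T, intp = intp C\<rparr>"
  define h where "h x = eval B bs (SOME t. t \<in> ?T \<and> eval C cs t = x)" for x
  have h: "h (eval C cs t) = eval B bs t" if t: "t \<in> ?T" for t
  proof -
    let ?u = "SOME u. u \<in> ?T \<and> eval C cs u = eval C cs t"
    have "?u \<in> ?T \<and> eval C cs ?u = eval C cs t"
      by (rule someI[of _ t]) (simp add: t)
    then show ?thesis unfolding h_def using t by (intro agree) auto
  qed
  have subB: "subuniverse \<sigma> B (eval B bs ` ?T)"
    by (rule subuniverse_eval_image[OF B(1,2)])
  have subC: "subuniverse \<sigma> C (eval C cs ` ?T)"
    by (rule subuniverse_eval_image[OF C])
  have "set bs \<subseteq> eval B bs ` ?T"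
  proof
    fix b assume "b \<in> set bs"
    then obtain i where "i < k" "b = bs ! i"
      using nlistsE_length[OF B(2)] by (auto simp: in_set_conv_nth)
    then show "b \<in> eval B bs ` ?T"
      using terms.intros(1)[of i k \<sigma>] by force
  qed
  then have im: "eval B bs ` ?T = carrier B"
    using hull_minimal[of "set bs" _ "subuniverse \<sigma> B"] subB B(3)
    by (metis antisym subuniverse_def)
  then have "?T \<noteq> {}"
    using B(1) by (auto simp: is_algebra_def)
  then show "subalgebra \<sigma> ?S C"
    using subC by (auto simp: subalgebra_def is_algebra_def subuniverse_def)
  have "h (intp C f xs) = intp B f (map h xs)"
    if f: "f \<in> syms \<sigma>" and xs: "xs \<in> nlists (arity \<sigma> f) (eval C cs ` ?T)" for f xs
  proof -
    have "xs \<in> map (eval C cs) ` lists ?T"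
      using xs by (metis in_lists_conv_set lists_image nlistsE_set subsetD)
    then obtain ts where ts: "xs = map (eval C cs) ts" "set ts \<subseteq> ?T" by auto
    have "Fun f ts \<in> ?T"
      using f nlistsE_length[OF xs] ts by (intro terms.intros) auto
    from h[OF this] have "h (intp C f xs) = intp B f (map (eval B bs) ts)"
      using ts(1) by simp
    also have "map (eval B bs) ts = map h xs"
      using ts h by auto
    finally show ?thesis .
  qed
  moreover have "h ` eval C cs ` ?T = carrier B"
    unfolding im[symmetric] image_image using h by simp
  ultimately show "hom_image \<sigma> ?S B"
    unfolding hom_image_def is_hom_def by (intro exI[of _ h]) simp
qed

lemma finitely_determined_generators_in_pseudovariety:
  fixes A :: "('f, 'a) algebra" and B :: "('f, 'b) algebra"
  assumes A: "is_algebra \<sigma> A" and B: "is_algebra \<sigma> B"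
    and bs: "set bs \<subseteq> carrier B" "(subuniverse \<sigma> B) hull (set bs) = carrier B"
    and fd: "finitely_determined \<sigma> A B bs"
  shows "in_pseudovariety \<sigma> A B"
proof -
  define k where "k = length bs"
  obtain F where F: "finite F" "F \<subseteq> nlists k (carrier A)"
    "\<And>s t. s \<in> terms \<sigma> k \<Longrightarrow> t \<in> terms \<sigma> k \<Longrightarrow> \<forall>as\<in>F. eval A as s = eval A as t \<Longrightarrow>
       eval B bs s = eval B bs t"
    using fd unfolding finitely_determined_def k_def by blast
  obtain rows where rows: "set rows = F" using finite_list[OF F(1)] by blast
  \<comment> \<open>The algebras of the pseudovariety live on nested tuples, so \<open>A\<close> is replaced by a copy.\<close>
  obtain E where E: "is_algebra \<sigma> E" "is_hom \<sigma> Atom A E" "bij_betw Atom (carrier A) (carrier E)"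
    using ex_isomorphic_copy[OF A, of Atom] by (metis inj_onI nested.inject(1))
  define P where "P = product (replicate (length rows) E)"
  have P: "pseudovariety \<sigma> A P"
    unfolding P_def
    using E by (auto intro!: pseudovariety.product pseudovariety.generator simp: isomorphic_def)
  have Palg: "is_algebra \<sigma> P"
    unfolding P_def using E(1) by (intro is_algebra_product) simp
  define cols where "cols = map (\<lambda>i. Tuple (map (\<lambda>as. Atom (as ! i)) rows)) [0..<k]"
  have row: "rows ! j \<in> nlists k (carrier A)" if "j < length rows" for j
    using that rows F(2) by auto
  have AtomE: "Atom a \<in> carrier E" if "a \<in> carrier A" for a
    using that E(3) by (auto simp: bij_betw_def)
  have cols: "cols \<in> nlists k (carrier P)"
  proof -
    have "Tuple (map (\<lambda>as. Atom (as ! i)) rows) \<in> carrier P" if "i < k" for i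
      unfolding P_def in_carrier_product_iff
      using AtomE nlistsE_nth_in[OF row that] by simp
    then show ?thesis by (auto simp: nlists_def cols_def)
  qed
  have ev: "eval P cols t = Tuple (map (\<lambda>as. Atom (eval A as t)) rows)" if t: "t \<in> terms \<sigma> k" for t
  proof -
    have "eval E (map (\<lambda>x. entries x ! j) cols) t = Atom (eval A (rows ! j) t)"
      if j: "j < length rows" for j
    proof -
      have "map (\<lambda>x. entries x ! j) cols = map Atom (rows ! j)"
        using j nlistsE_length[OF row[OF j]] by (intro nth_equalityI) (simp_all add: cols_def)
      then show ?thesis
        using hom_eval[OF A E(2) t row[OF j]] by simp
    qed
    then show ?thesis
      unfolding P_def using eval_product[OF t cols[unfolded P_def]]
      by (auto intro: nth_equalityI)
  qed
  have agree: "eval B bs s = eval B bs t"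
    if "s \<in> terms \<sigma> k" "t \<in> terms \<sigma> k" "eval P cols s = eval P cols t" for s t
    by (rule F(3)[OF that(1,2)]) (use that rows in \<open>auto simp: ev\<close>)
  have "bs \<in> nlists k (carrier B)" using bs(1) by (simp add: nlists_def k_def)
  from generated_subalgebra_hom_image[OF B this bs(2) Palg cols agree]
  obtain S where S: "subalgebra \<sigma> S P" "hom_image \<sigma> S B" by blast
  have "isomorphic \<sigma> S S"
    unfolding isomorphic_def by (intro exI[of _ id]) (simp add: is_hom_def)
  then have "in_pseudovariety \<sigma> A S"
    using pseudovariety.subalgebra[OF P S(1)] S(1)
    by (auto simp: in_pseudovariety_def subalgebra_def)
  then show ?thesis
    using in_pseudovariety_hom_image B S(2) by blast
qed

theorem corollary5p2:
  fixes \<sigma> :: "'f signature"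
    and A :: "('f, 'a) algebra"
    and B :: "('f, 'b) algebra"
  assumes "is_algebra \<sigma> A" and "finitely_generated \<sigma> A"
    and "is_algebra \<sigma> B" and "finitely_generated \<sigma> B"
  shows "in_pseudovariety \<sigma> A B \<longleftrightarrow>
    natural_map_well_defined \<sigma> A B \<and> clone_uniformly_continuous \<sigma> A B (natural_map \<sigma> A B)"
proof -
  have "carrier A \<noteq> {}" using assms(1) by (simp add: is_algebra_def)
  note iff = natural_map_uniformly_continuous_iff[OF this]
  show ?thesis
    unfolding iff
  proof
    assume "in_pseudovariety \<sigma> A B"
    then show "\<forall>bs. bs \<noteq> [] \<and> set bs \<subseteq> carrier B \<longrightarrow> finitely_determined \<sigma> A B bs"
      using in_pseudovariety_finitely_determined[OF assms(1)] by blast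
  next
    assume fd: "\<forall>bs. bs \<noteq> [] \<and> set bs \<subseteq> carrier B \<longrightarrow> finitely_determined \<sigma> A B bs"
    obtain X where X: "finite X" "X \<subseteq> carrier B" "(subuniverse \<sigma> B) hull X = carrier B"
      using assms(4) by (auto simp: finitely_generated_def)
    obtain xs where xs: "set xs = X" using finite_list[OF X(1)] by blast
    obtain b where b: "b \<in> carrier B" using assms(3) by (auto simp: is_algebra_def)
    \<comment> \<open>The generating set may be empty, but operations of arity 0 do not belong to the clone;
      hence an element is added.\<close>
    have bs: "set (b # xs) \<subseteq> carrier B" using b X(2) xs by simp
    have "(subuniverse \<sigma> B) hull (set (b # xs)) = carrier B"
    proof
      show "(subuniverse \<sigma> B) hull (set (b # xs)) \<subseteq> carrier B"
        using bs assms(3) by (intro hull_minimal) (auto simp: is_algebra_def)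
      show "carrier B \<subseteq> (subuniverse \<sigma> B) hull (set (b # xs))"
        unfolding X(3)[symmetric] xs[symmetric] by (intro hull_mono) auto
    qed
    then show "in_pseudovariety \<sigma> A B"
      using finitely_determined_generators_in_pseudovariety[OF assms(1,3) bs] fd bs by blast
  qed
qed

end
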